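(* Let $L$ be a Leibniz algebra over a field of nilpotent length $2$ or less. Then the Cartan subalgebras of $L$ are precisely the subalgebras in $M(L)$.
   Context: Leibniz algebras are finite-dimensional left Leibniz algebras over a field: the product satisfies $x(yz)=(xy)z+y(xz)$. The normalizer of a subalgebra $C$ in $L$ is $\mathcal{N}_L(C)=\{x\in L: xC\subseteq C \text{ and } Cx\subseteq C\}$; $C$ is self-normalizing in $L$ if $\mathcal{N}_L(C)=C$. A Cartan subalgebra of $L$ is a nilpotent self-normalizing subalgebra. $M(L)$ is the set of subalgebras $A$ of $L$ such that: (1) $A$ can be joined to $L$ by a (finite, possibly trivial) chain of subalgebras of $L$, each maximal and self-normalizing in the next; and (2) no maximal subalgebra of $A$ is self-normalizing in $A$. The algebra $L$ is nilpotent of length $t$ (has nilpotent length $t$) if $t$ is the smallest natural number such that there is a chain of ideals $0=L_0\subseteq L_1\subseteq\cdots\subseteq L_t=L$ of $L$ with every factor $L_{i+1}/L_i$ nilpotent. *)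

theory Defs
  imports Complex_Main
begin

text \<open>
  An algebra over a field \<open>'k\<close>, not necessarily associative or unital, given by an explicit
  carrier and operations, so that subalgebras and factor algebras are both instances and
  nilpotency is one notion for all of them.
\<close>

record ('k, 'a) alg =
  carr :: "'a set"
  azero :: 'a
  aadd :: "'a \<Rightarrow> 'a \<Rightarrow> 'a"
  ascale :: "'k \<Rightarrow> 'a \<Rightarrow> 'a"
  aprod :: "'a \<Rightarrow> 'a \<Rightarrow> 'a"

inductive_set lin_span :: "('k, 'a) alg \<Rightarrow> 'a set \<Rightarrow> 'a set"
  for Q :: "('k, 'a) alg" and S :: "'a set" where
  zero: "azero Q \<in> lin_span Q S"
| step: "x \<in> S \<Longrightarrow> y \<in> lin_span Q S \<Longrightarrow> aadd Q (ascale Q c x) y \<in> lin_span Q S"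

definition prod_space :: "('k, 'a) alg \<Rightarrow> 'a set \<Rightarrow> 'a set \<Rightarrow> 'a set" where
  "prod_space Q U V = lin_span Q {aprod Q u v | u v. u \<in> U \<and> v \<in> V}"

text \<open>
  \<open>lower_central Q n\<close> is the term usually written \<open>Q\<^sup>n\<^sup>+\<^sup>1\<close>, with \<open>Q\<^sup>1 = Q\<close> and
  \<open>Q\<^sup>k\<^sup>+\<^sup>1 = Q Q\<^sup>k\<close>. The side matters: for left Leibniz algebras it is these products,
  nested to the right, that span all products of \<open>k + 1\<close> factors. With \<open>Q\<^sup>k Q\<close> the algebra
  spanned by \<open>x, y\<close> with \<open>xx = xy = y\<close> and \<open>yx = yy = 0\<close> would count as nilpotent.
\<close>

primrec lower_central :: "('k, 'a) alg \<Rightarrow> nat \<Rightarrow> 'a set" where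
  "lower_central Q 0 = carr Q"
| "lower_central Q (Suc n) = prod_space Q (carr Q) (lower_central Q n)"

definition nilpotent_alg :: "('k, 'a) alg \<Rightarrow> bool" where
  "nilpotent_alg Q \<longleftrightarrow> (\<exists>n. lower_central Q n = {azero Q})"

text \<open>Finite-dimensional left Leibniz algebras; the algebra is the whole type \<open>'v\<close>.\<close>

locale leibniz_algebra = vector_space scale
  for scale :: "'k::field \<Rightarrow> 'v::ab_group_add \<Rightarrow> 'v" +
  fixes mult :: "'v \<Rightarrow> 'v \<Rightarrow> 'v"
  assumes mult_add_left: "mult (x + y) z = mult x z + mult y z"
    and mult_add_right: "mult x (y + z) = mult x y + mult x z"
    and mult_scale_left: "mult (scale c x) y = scale c (mult x y)"
    and mult_scale_right: "mult x (scale c y) = scale c (mult x y)"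
    and left_leibniz: "mult x (mult y z) = mult (mult x y) z + mult y (mult x z)"
    and finite_dimensional: "\<exists>B. finite B \<and> span B = UNIV"
begin

definition subalgebra :: "'v set \<Rightarrow> bool" where
  "subalgebra A \<longleftrightarrow> subspace A \<and> (\<forall>x\<in>A. \<forall>y\<in>A. mult x y \<in> A)"

definition leibniz_ideal :: "'v set \<Rightarrow> bool" where
  "leibniz_ideal I \<longleftrightarrow> subspace I \<and> (\<forall>x. \<forall>y\<in>I. mult x y \<in> I \<and> mult y x \<in> I)"

definition alg_on :: "'v set \<Rightarrow> ('k, 'v) alg" where
  "alg_on A = \<lparr>carr = A, azero = 0, aadd = (+), ascale = scale, aprod = mult\<rparr>"

definition coset :: "'v set \<Rightarrow> 'v \<Rightarrow> 'v set" where
  "coset I x = (+) x ` I"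

text \<open>
  The factor algebra \<open>A/I\<close>, for a subalgebra \<open>A\<close> and an ideal \<open>I \<subseteq> A\<close>. The unions run over
  all representatives; see the lemmas \<open>factor_simps\<close> below.
\<close>

definition factor :: "'v set \<Rightarrow> 'v set \<Rightarrow> ('k, 'v set) alg" where
  "factor A I =
    \<lparr>carr = coset I ` A,
     azero = I,
     aadd = (\<lambda>X Y. \<Union>x\<in>X. \<Union>y\<in>Y. coset I (x + y)),
     ascale = (\<lambda>c X. \<Union>x\<in>X. coset I (scale c x)),
     aprod = (\<lambda>X Y. \<Union>x\<in>X. \<Union>y\<in>Y. coset I (mult x y))\<rparr>"

definition normalizer :: "'v set \<Rightarrow> 'v set \<Rightarrow> 'v set" where
  "normalizer A C = {x \<in> A. \<forall>c\<in>C. mult x c \<in> C \<and> mult c x \<in> C}"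

definition self_normalizing :: "'v set \<Rightarrow> 'v set \<Rightarrow> bool" where
  "self_normalizing A C \<longleftrightarrow> normalizer A C = C"

definition cartan_subalgebra :: "'v set \<Rightarrow> bool" where
  "cartan_subalgebra C \<longleftrightarrow>
    subalgebra C \<and> nilpotent_alg (alg_on C) \<and> self_normalizing UNIV C"

definition maximal_subalgebra :: "'v set \<Rightarrow> 'v set \<Rightarrow> bool" where
  "maximal_subalgebra A U \<longleftrightarrow>
    subalgebra A \<and> subalgebra U \<and> U \<subset> A \<and>
    (\<forall>W. subalgebra W \<and> U \<subseteq> W \<and> W \<subseteq> A \<longrightarrow> W = U \<or> W = A)"

definition M_set :: "'v set set" where
  "M_set = {A. subalgebra A \<and>
    (\<lambda>U V. maximal_subalgebra V U \<and> self_normalizing V U)\<^sup>*\<^sup>* A UNIV \<and>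
    \<not> (\<exists>U. maximal_subalgebra A U \<and> self_normalizing A U)}"

definition nilpotent_chain :: "nat \<Rightarrow> bool" where
  "nilpotent_chain t \<longleftrightarrow> (\<exists>I :: nat \<Rightarrow> 'v set.
    I 0 = {0} \<and> I t = UNIV \<and>
    (\<forall>i\<le>t. leibniz_ideal (I i)) \<and>
    (\<forall>i<t. I i \<subseteq> I (Suc i) \<and> nilpotent_alg (factor (I (Suc i)) (I i))))"

definition has_nilpotent_length :: "nat \<Rightarrow> bool" where
  "has_nilpotent_length t \<longleftrightarrow> nilpotent_chain t \<and> (\<forall>s<t. \<not> nilpotent_chain s)"

lemma coset_eq:
  assumes "subspace I" "y \<in> coset I x"
  shows "coset I y = coset I x"
proof -
  obtain a where a: "a \<in> I" "y = x + a"
    using assms(2) by (auto simp: coset_def)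
  have "x + a + b \<in> (+) x ` I" if "b \<in> I" for b
    using subspace_add[OF assms(1) a(1) that] by (auto simp: add.assoc)
  moreover have "x + b \<in> (+) (x + a) ` I" if "b \<in> I" for b
    using subspace_diff[OF assms(1) that a(1)] by (intro image_eqI[of _ _ "b - a"]) auto
  ultimately show ?thesis
    unfolding coset_def a(2) by auto
qed

lemma coset_self: "subspace I \<Longrightarrow> x \<in> coset I x"
  unfolding coset_def by (intro image_eqI[of _ _ 0]) (auto simp: subspace_0)

lemma factor_simps:
  assumes "leibniz_ideal I"
  shows "azero (factor A I) = coset I 0"
    and "aadd (factor A I) (coset I x) (coset I y) = coset I (x + y)"
    and "ascale (factor A I) c (coset I x) = coset I (scale c x)"
    and "aprod (factor A I) (coset I x) (coset I y) = coset I (mult x y)"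
proof -
  have I: "subspace I" and idl: "\<And>x y. y \<in> I \<Longrightarrow> mult x y \<in> I" "\<And>x y. y \<in> I \<Longrightarrow> mult y x \<in> I"
    using assms by (auto simp: leibniz_ideal_def)
  show "azero (factor A I) = coset I 0"
    by (auto simp: factor_def coset_def)
  have mem: "z \<in> coset I w" if "z - w \<in> I" for z w
    unfolding coset_def using that by (intro image_eqI[of _ _ "z - w"]) auto
  have dif: "z - w \<in> I" if "z \<in> coset I w" for z w
    using that by (auto simp: coset_def)
  have "coset I (u + v) = coset I (x + y)" if "u \<in> coset I x" "v \<in> coset I y" for u v
  proof (rule coset_eq[OF I mem])
    have "u + v - (x + y) = (u - x) + (v - y)" by simp
    then show "u + v - (x + y) \<in> I"
      using subspace_add[OF I dif[OF that(1)] dif[OF that(2)]] by (simp only:)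
  qed
  then have "(\<Union>u\<in>coset I x. \<Union>v\<in>coset I y. coset I (u + v)) = coset I (x + y)"
    using coset_self[OF I] by blast
  then show "aadd (factor A I) (coset I x) (coset I y) = coset I (x + y)"
    by (simp add: factor_def)
  have "coset I (scale c u) = coset I (scale c x)" if "u \<in> coset I x" for u
    by (rule coset_eq[OF I mem])
      (use subspace_scale[OF I dif[OF that]] in \<open>simp add: scale_right_diff_distrib\<close>)
  then have "(\<Union>u\<in>coset I x. coset I (scale c u)) = coset I (scale c x)"
    using coset_self[OF I] by blast
  then show "ascale (factor A I) c (coset I x) = coset I (scale c x)"
    by (simp add: factor_def)
  have "coset I (mult u v) = coset I (mult x y)" if "u \<in> coset I x" "v \<in> coset I y" for u v
  proof (rule coset_eq[OF I mem])
    have "mult u v = mult ((u - x) + x) ((v - y) + y)" by simp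
    also have "\<dots> = mult (u - x) v + mult x (v - y) + mult x y"
      by (simp only: mult_add_left mult_add_right[of x]) simp
    finally show "mult u v - mult x y \<in> I"
      using subspace_add[OF I idl(2)[OF dif[OF that(1)], of v] idl(1)[OF dif[OF that(2)], of x]]
      by simp
  qed
  then have "(\<Union>u\<in>coset I x. \<Union>v\<in>coset I y. coset I (mult u v)) = coset I (mult x y)"
    using coset_self[OF I] by blast
  then show "aprod (factor A I) (coset I x) (coset I y) = coset I (mult x y)"
    by (simp add: factor_def)
qed

end

end

theory Submission
  imports Defs
begin

text \<open>
  The key fact concerns a nilpotent subalgebra \<open>C\<close> acting by left multiplications on a factor
  space \<open>W/U\<close>: if there are no nonzero invariants, then \<open>W = U + CW\<close> (Fitting decomposition and
  Engel's theorem). When \<open>C\<close> is self-normalizing in \<open>H\<close>, this applies to \<open>H/C\<close>, so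
  \<open>H = C + CH\<close>. Used for the normalizer of a subalgebra \<open>M \<supseteq> C\<close>, it shows that \<open>M\<close> is
  self-normalizing, so every chain of maximal subalgebras above a Cartan subalgebra is as required.

  Conversely, if all maximal subalgebras of \<open>A\<close> are ideals, then every left multiplication of \<open>A\<close>
  is nilpotent, since a proper Fitting null component would lie in a maximal subalgebra that also
  contains the Fitting one component; hence \<open>A\<close> is nilpotent. If \<open>N\<close> is a nilpotent ideal with
  nilpotent factor and \<open>M\<close> is maximal and self-normalizing in \<open>H\<close>, then \<open>K = M \<inter> N\<close> is an ideal
  of \<open>H\<close>, and a Cartan subalgebra \<open>A\<close> of \<open>M\<close> satisfies \<open>M = A + K\<close>. So the normalizer of \<open>A\<close> in
  \<open>H\<close> normalizes \<open>M\<close>, hence lies in \<open>M\<close>, and therefore equals \<open>A\<close>.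
\<close>

context leibniz_algebra
begin

subsection \<open>Subspaces and the product\<close>

text \<open>The assumption on dimension gives a finite spanning set. An independent subset that
  still spans allows the locale with a fixed basis to be interpreted.\<close>

lemma finite_dimensional_basis:
  obtains B where "finite_dimensional_vector_space scale B"
proof -
  obtain B0 where B0: "finite B0" "span B0 = UNIV"
    using finite_dimensional by blast
  obtain B where "B \<subseteq> B0" "independent B" "B0 \<subseteq> span B"
    using maximal_independent_subset[of B0] by blast
  moreover have "span B = UNIV"
    using B0(2) span_mono[OF \<open>B0 \<subseteq> span B\<close>] by (simp add: span_span top.extremum_unique)
  ultimately have "finite_dimensional_vector_space scale B"
    using B0(1) by unfold_locales (auto intro: finite_subset)
  then show thesis by (rule that)
qed

lemma dim_less:
  assumes "subspace S" "subspace T" "S \<subset> T"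
  shows "dim S < dim T"
proof -
  obtain B where "finite_dimensional_vector_space scale B"
    by (rule finite_dimensional_basis)
  then interpret fd: finite_dimensional_vector_space scale B .
  show ?thesis
    using assms by (intro fd.dim_psubset) (simp add: span_eq_iff[THEN iffD2])
qed

lemma dim_le_UNIV: "subspace S \<Longrightarrow> dim S \<le> dim (UNIV :: 'v set)"
  using dim_less[of S UNIV] by (metis le_less psubsetI subspace_UNIV subset_UNIV)

lemma finite_spanning_subset:
  assumes "subspace S"
  obtains F where "finite F" "F \<subseteq> S" "S \<subseteq> span F"
proof -
  obtain B where "finite_dimensional_vector_space scale B"
    by (rule finite_dimensional_basis)
  then interpret fd: finite_dimensional_vector_space scale B .
  show thesis
    using maximal_independent_subset[of S] fd.finiteI_independent that by metis
qed

section \<open>Consequences of bilinearity and of the Leibniz identity\<close>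

lemma mult_zero_right [simp]: "mult x 0 = 0"
  using mult_add_right[of x 0 0] by simp

lemma mult_zero_left [simp]: "mult 0 x = 0"
  using mult_add_left[of 0 0 x] by simp

lemma mult_diff_right: "mult x (y - z) = mult x y - mult x z"
  using mult_add_right[of x "y - z" z] by (simp add: algebra_simps)

lemma mult_diff_left: "mult (x - y) z = mult x z - mult y z"
  using mult_add_left[of "x - y" y z] by (simp add: algebra_simps)

lemma mult_square_left [simp]: "mult (mult x x) z = 0"
  using left_leibniz[of x x z] by simp

text \<open>Adding the Leibniz identities for \<open>x, y\<close> and for \<open>y, x\<close> leaves
  this substitute for anticommutativity.\<close>

lemma mult_mult_swap: "mult (mult x y) z = - mult (mult y x) z"
  using left_leibniz[of x y z] left_leibniz[of y x z]
  by (simp add: algebra_simps eq_neg_iff_add_eq_0)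

text \<open>Left multiplication by a product is the commutator of the two left
  multiplications.\<close>

lemma mult_mult_eq: "mult (mult x y) z = mult x (mult y z) - mult y (mult x z)"
  using left_leibniz[of x y z] by simp

lemma subspace_vimage_left: "subspace U \<Longrightarrow> subspace {x. mult x y \<in> U}"
  by (auto simp: subspace_def mult_add_left mult_scale_left)

lemma subspace_multiplier_left: "subspace U \<Longrightarrow> subspace {y. \<forall>x\<in>A. mult x y \<in> U}"
  by (auto simp: subspace_def mult_add_right mult_scale_right)

lemma mult_funpow_zero [simp]: "(mult a ^^ k) 0 = 0"
  by (induction k) auto

lemma mult_funpow_add: "(mult a ^^ k) (x + y) = (mult a ^^ k) x + (mult a ^^ k) y"
  by (induction k) (auto simp: mult_add_right)

lemma mult_funpow_diff: "(mult a ^^ k) (x - y) = (mult a ^^ k) x - (mult a ^^ k) y"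
  by (induction k) (auto simp: mult_diff_right)

lemma mult_funpow_scale: "(mult a ^^ k) (scale c x) = scale c ((mult a ^^ k) x)"
  by (induction k) (auto simp: mult_scale_right)

lemma mult_funpow_mem: "\<forall>u\<in>U. mult a u \<in> U \<Longrightarrow> u \<in> U \<Longrightarrow> (mult a ^^ k) u \<in> U"
  by (induction k) auto

lemma mult_funpow_mem_le:
  assumes "\<forall>u\<in>U. mult a u \<in> U" "(mult a ^^ k) w \<in> U" "k \<le> l"
  shows "(mult a ^^ l) w \<in> U"
proof -
  have "(mult a ^^ l) w = (mult a ^^ (l - k)) ((mult a ^^ k) w)"
    using assms(3) by (metis comp_apply funpow_add le_add_diff_inverse2)
  then show ?thesis
    using mult_funpow_mem[OF assms(1,2)] by simp
qed

lemma subalgebraD: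
  assumes "subalgebra A"
  shows "subspace A" "x \<in> A \<Longrightarrow> y \<in> A \<Longrightarrow> mult x y \<in> A"
  using assms by (auto simp: subalgebra_def)

lemma subalgebra_normalizer:
  assumes "subalgebra A" "subspace C"
  shows "subalgebra (normalizer A C)"
proof -
  have "subspace (normalizer A C)"
    using assms unfolding normalizer_def subalgebra_def subspace_def
    by (auto simp: mult_add_left mult_add_right mult_scale_left mult_scale_right)
  moreover have "mult x y \<in> normalizer A C"
    if x: "x \<in> normalizer A C" and y: "y \<in> normalizer A C" for x y
  proof -
    have "mult (mult x y) c \<in> C" if "c \<in> C" for c
      using x y that subspace_diff[OF assms(2)] by (auto simp: normalizer_def mult_mult_eq)
    moreover have "mult c (mult x y) \<in> C" if "c \<in> C" for c
      using x y that subspace_add[OF assms(2)] by (auto simp: normalizer_def left_leibniz[of c])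
    ultimately show ?thesis
      using x y assms(1) by (auto simp: normalizer_def subalgebra_def)
  qed
  ultimately show ?thesis
    by (auto simp: subalgebra_def)
qed

lemma subset_normalizer: "subalgebra C \<Longrightarrow> C \<subseteq> A \<Longrightarrow> C \<subseteq> normalizer A C"
  by (auto simp: normalizer_def subalgebra_def)

text \<open>A proper subalgebra above \<open>V\<close> of greatest dimension is maximal.\<close>

lemma maximal_subalgebra_exists:
  assumes "subalgebra A" "subalgebra V" "V \<subset> A"
  obtains M where "maximal_subalgebra A M" "V \<subseteq> M"
proof -
  let ?P = "\<lambda>W. subalgebra W \<and> V \<subseteq> W \<and> W \<subset> A"
  obtain M where M: "?P M" "\<And>W. ?P W \<Longrightarrow> dim W \<le> dim M"
    using ex_has_greatest_nat[of ?P V dim "Suc (dim (UNIV :: 'v set))"] assms dim_le_UNIV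
    by (metis le_imp_less_Suc order_refl subalgebraD(1))
  have "W = M \<or> W = A" if "subalgebra W" "M \<subseteq> W" "W \<subseteq> A" for W
    using M(1) M(2)[of W] that dim_less[of M W] by (fastforce simp: subalgebra_def)
  then have "maximal_subalgebra A M"
    using M(1) assms by (auto simp: maximal_subalgebra_def)
  then show thesis
    using M(1) that by blast
qed

subsection \<open>Lower central and derived series\<close>

primrec lcs :: "'v set \<Rightarrow> nat \<Rightarrow> 'v set" where
  "lcs A 0 = A"
| "lcs A (Suc n) = span {mult x y | x y. x \<in> A \<and> y \<in> lcs A n}"

primrec derived :: "'v set \<Rightarrow> nat \<Rightarrow> 'v set" where
  "derived A 0 = A"
| "derived A (Suc n) = span {mult x y | x y. x \<in> derived A n \<and> y \<in> derived A n}"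

text \<open>Inclusion in place of equality makes the notion monotone on arbitrary sets.\<close>

definition nilpotent_sub :: "'v set \<Rightarrow> bool" where
  "nilpotent_sub A \<longleftrightarrow> (\<exists>n. lcs A n \<subseteq> {0})"

definition solvable_sub :: "'v set \<Rightarrow> bool" where
  "solvable_sub A \<longleftrightarrow> (\<exists>n. derived A n \<subseteq> {0})"

lemma lcs_mono: "A \<subseteq> B \<Longrightarrow> lcs A n \<subseteq> lcs B n"
proof (induction n)
  case (Suc n)
  then show ?case unfolding lcs.simps by (intro span_mono) blast
qed simp

lemma lcs_mult: "x \<in> A \<Longrightarrow> y \<in> lcs A n \<Longrightarrow> mult x y \<in> lcs A (Suc n)"
  by (auto intro: span_base)

lemma lcs_subspace: "subspace A \<Longrightarrow> subspace (lcs A n)"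
  by (cases n) auto

lemma lcs_subset: "subalgebra A \<Longrightarrow> lcs A n \<subseteq> A"
proof (induction n)
  case (Suc n)
  then show ?case
    unfolding lcs.simps by (intro span_minimal) (auto simp: subalgebra_def)
qed simp

lemma lcs_funpow: "a \<in> A \<Longrightarrow> x \<in> A \<Longrightarrow> (mult a ^^ n) x \<in> lcs A n"
proof (induction n)
  case (Suc n)
  then show ?case using lcs_mult by simp
qed simp

lemma nilpotent_sub_mono: "nilpotent_sub B \<Longrightarrow> A \<subseteq> B \<Longrightarrow> nilpotent_sub A"
  unfolding nilpotent_sub_def using lcs_mono by blast

lemma derived_mono: "A \<subseteq> B \<Longrightarrow> derived A n \<subseteq> derived B n"
proof (induction n)
  case (Suc n)
  then show ?case unfolding derived.simps by (intro span_mono) blast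
qed simp

lemma derived_subspace: "subspace A \<Longrightarrow> subspace (derived A n)"
  by (cases n) auto

lemma derived_subset: "subalgebra A \<Longrightarrow> derived A n \<subseteq> A"
proof (induction n)
  case (Suc n)
  then show ?case
    unfolding derived.simps by (intro span_minimal) (auto simp: subalgebra_def)
qed simp

lemma derived_mult: "x \<in> derived A n \<Longrightarrow> y \<in> derived A n \<Longrightarrow> mult x y \<in> derived A (Suc n)"
  by (auto intro: span_base)

lemma derived_add: "derived (derived A m) n = derived A (m + n)"
  by (induction n) auto

lemma derived_subset_lcs: "subalgebra A \<Longrightarrow> derived A n \<subseteq> lcs A n"
proof (induction n)
  case (Suc n)
  then show ?case
    using derived_subset[OF Suc.prems, of n]
    unfolding derived.simps lcs.simps by (intro span_mono) blast
qed simp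

lemma nilpotent_solvable: "subalgebra A \<Longrightarrow> nilpotent_sub A \<Longrightarrow> solvable_sub A"
  unfolding nilpotent_sub_def solvable_sub_def using derived_subset_lcs by blast

text \<open>Induction through \<open>(y z) a = y (z a) - z (y a)\<close>. In
  \<open>engel_step\<close> this keeps \<open>x s\<close> in \<open>K\<close> when
  \<open>x (s w)\<close> is expanded.\<close>

lemma derived_right_ideal:
  assumes "subalgebra A" "x \<in> derived A n" "a \<in> A"
  shows "mult x a \<in> derived A n"
  using assms(2,3)
proof (induction n arbitrary: x a)
  case 0
  then show ?case using assms(1) by (simp add: subalgebra_def)
next
  case (Suc n)
  let ?S = "{x. mult x a \<in> derived A (Suc n)}"
  have "derived A (Suc n) \<subseteq> ?S"
    unfolding derived.simps(2)
  proof (rule span_minimal, safe)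
    fix y z assume yz: "y \<in> derived A n" "z \<in> derived A n"
    have "mult y (mult z a) \<in> derived A (Suc n)" "mult z (mult y a) \<in> derived A (Suc n)"
      using yz Suc.IH Suc.prems derived_mult by blast+
    then have "mult (mult y z) a \<in> derived A (Suc n)"
      unfolding mult_mult_eq by (intro subspace_diff) auto
    then show "mult (mult y z) a \<in> span {mult x y |x y. x \<in> derived A n \<and> y \<in> derived A n}"
      by simp
  qed (rule subspace_vimage_left, simp)
  then show ?case using Suc.prems by blast
qed

section \<open>Nilpotency of \<open>alg_on\<close> and \<open>factor\<close> in terms of
  \<open>lcs\<close>\<close>

lemma lin_span_alg_on: "lin_span (alg_on A) S = span S"
proof
  show "lin_span (alg_on A) S \<subseteq> span S"
  proof
    fix x assume "x \<in> lin_span (alg_on A) S"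
    then show "x \<in> span S"
      by induction (auto simp: alg_on_def intro: span_add span_scale span_base span_zero)
  qed
  show "span S \<subseteq> lin_span (alg_on A) S"
  proof
    fix x assume "x \<in> span S"
    then show "x \<in> lin_span (alg_on A) S"
    proof (induction rule: span_induct_alt)
      case base
      show ?case using lin_span.zero[of "alg_on A" S] by (simp add: alg_on_def)
    next
      case (step c x y)
      then show ?case using lin_span.step[of x S y "alg_on A" c] by (simp add: alg_on_def)
    qed
  qed
qed

lemma lower_central_alg_on: "lower_central (alg_on A) n = lcs A n"
proof (induction n)
  case (Suc n)
  then show ?case
    by (simp add: prod_space_def lin_span_alg_on) (simp add: alg_on_def)
qed (simp add: alg_on_def)

lemma nilpotent_alg_on_iff:
  assumes "subspace A"
  shows "nilpotent_alg (alg_on A) \<longleftrightarrow> nilpotent_sub A"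
proof -
  have "lcs A n = {0} \<longleftrightarrow> lcs A n \<subseteq> {0}" for n
    using subspace_0[OF lcs_subspace[OF assms]] by blast
  then show ?thesis
    unfolding nilpotent_alg_def nilpotent_sub_def lower_central_alg_on by (simp add: alg_on_def)
qed

text \<open>By \<open>factor_simps\<close> the map \<open>coset I\<close> respects all operations,
  so it carries each term of one series into the same term of the other.\<close>

lemma coset_lcs:
  assumes "leibniz_ideal I" "x \<in> lcs A n"
  shows "coset I x \<in> lower_central (factor A I) n"
  using assms(2)
proof (induction n arbitrary: x)
  case 0
  then show ?case by (simp add: factor_def)
next
  case (Suc n)
  from Suc.prems show ?case
    unfolding lcs.simps lower_central.simps prod_space_def
  proof (induction rule: span_induct_alt)
    case base
    then show ?case
      using lin_span.zero[of "factor A I"] factor_simps(1)[OF assms(1)] by simp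
  next
    case (step c x y)
    then obtain a b where ab: "x = mult a b" "a \<in> A" "b \<in> lcs A n" by blast
    have "coset I x \<in> {aprod (factor A I) u v | u v.
        u \<in> carr (factor A I) \<and> v \<in> lower_central (factor A I) n}"
      using ab Suc.IH factor_simps(4)[OF assms(1), of A a b, symmetric]
      by (auto simp: factor_def)
    from lin_span.step[OF this step(2), of c] show ?case
      by (simp add: factor_simps[OF assms(1)])
  qed
qed

lemma nilpotent_factor_lcs:
  assumes "leibniz_ideal I" "nilpotent_alg (factor A I)"
  obtains n where "lcs A n \<subseteq> I"
proof -
  obtain n where n: "lower_central (factor A I) n = {azero (factor A I)}"
    using assms(2) by (auto simp: nilpotent_alg_def)
  have "x \<in> I" if "x \<in> lcs A n" for x
  proof -
    have "coset I x = I"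
      using coset_lcs[OF assms(1) that] n by (simp add: factor_def)
    then show ?thesis
      using coset_self[of I x] assms(1) by (auto simp: leibniz_ideal_def)
  qed
  then show thesis using that by blast
qed

subsection \<open>Engel's theorem and Fitting decompositions\<close>

text \<open>To be used with \<open>J\<close>, \<open>K\<close> consecutive terms of the derived
  series. Elements \<open>s\<close> of a finite spanning set of \<open>J\<close> are added to
  \<open>G\<close> one at a time. As products in \<open>J\<close> fall into \<open>K\<close>, the
  space \<open>Y G\<close> is stable under \<open>J\<close>, and \<open>s\<close> acts nilpotently
  on it modulo \<open>U\<close>.\<close>

lemma engel_step:
  assumes "subalgebra A" "subspace U" "subspace W"
    and AU: "\<forall>a\<in>A. \<forall>u\<in>U. mult a u \<in> U" and AW: "\<forall>a\<in>A. \<forall>w\<in>W. mult a w \<in> W"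
    and nil: "\<forall>a\<in>A. \<forall>w\<in>W. \<exists>k. (mult a ^^ k) w \<in> U"
    and J: "subspace J" "J \<subseteq> A" and JJ: "\<forall>x\<in>J. \<forall>y\<in>J. mult x y \<in> K"
    and KA: "\<forall>x\<in>K. \<forall>a\<in>A. mult x a \<in> K"
    and K: "\<exists>w\<in>W - U. \<forall>x\<in>K. mult x w \<in> U"
  shows "\<exists>w\<in>W - U. \<forall>x\<in>J. mult x w \<in> U"
proof -
  obtain F where F: "finite F" "F \<subseteq> J" "J \<subseteq> span F"
    using finite_spanning_subset[OF J(1)] .
  define Y where "Y G = {w\<in>W. (\<forall>x\<in>K. mult x w \<in> U) \<and> (\<forall>x\<in>G. mult x w \<in> U)}" for G
  have inv: "mult s w \<in> Y G" if "w \<in> Y G" "s \<in> J" "G \<subseteq> J" for s w G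
  proof -
    have s: "s \<in> A" using that J by blast
    have "mult x (mult s w) \<in> U" if "x \<in> K" for x
      unfolding left_leibniz[of x] using that \<open>w \<in> Y G\<close> s AU KA
      by (intro subspace_add[OF assms(2)]) (auto simp: Y_def)
    moreover have "mult x (mult s w) \<in> U" if "x \<in> G" for x
      unfolding left_leibniz[of x] using that \<open>w \<in> Y G\<close> \<open>s \<in> J\<close> \<open>G \<subseteq> J\<close> s AU JJ
      by (intro subspace_add[OF assms(2)]) (auto simp: Y_def)
    ultimately show ?thesis
      using that s AW by (auto simp: Y_def)
  qed
  have "\<exists>w. w \<in> Y F \<and> w \<notin> U"
    using F(1,2)
  proof (induction F rule: finite_induct)
    case empty
    then show ?case using K by (auto simp: Y_def)
  next
    case (insert s G)
    then obtain w where w: "w \<in> Y G" "w \<notin> U" by auto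
    have s: "s \<in> J" "s \<in> A" using insert.prems J by auto
    obtain k0 where "(mult s ^^ k0) w \<in> U"
      using nil s w by (fastforce simp: Y_def)
    \<comment> \<open>With \<open>k\<close> least, the vector one power earlier is outside
      \<open>U\<close> while \<open>s\<close> sends it into \<open>U\<close>.\<close>
    then obtain k where k: "(mult s ^^ k) w \<in> U" "\<And>j. j < k \<Longrightarrow> (mult s ^^ j) w \<notin> U"
      using exists_least_iff[of "\<lambda>k. (mult s ^^ k) w \<in> U"] by blast
    obtain j where j: "k = Suc j"
      using k(1) w(2) by (cases k) auto
    have "(mult s ^^ j) w \<in> Y G"
      using inv s insert.prems w by (intro mult_funpow_mem) auto
    then have "(mult s ^^ j) w \<in> Y (insert s G)"
      using k(1) by (auto simp: Y_def j)
    then show ?case using k(2) j by blast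
  qed
  then obtain w where w: "w \<in> Y F" "w \<notin> U" by blast
  have "span F \<subseteq> {x. mult x w \<in> U}"
    using w by (intro span_minimal subspace_vimage_left assms(2)) (auto simp: Y_def)
  then have "\<forall>x\<in>J. mult x w \<in> U"
    using F(3) by blast
  then show ?thesis
    using w by (auto simp: Y_def)
qed

text \<open>The induction climbs the derived series from a zero term, for which any vector of
  \<open>W\<close> outside \<open>U\<close> serves, up to \<open>A\<close> itself.\<close>

lemma engel:
  assumes A: "subalgebra A" "solvable_sub A" and UW: "subspace U" "subspace W" "U \<subset> W"
    and AU: "\<forall>a\<in>A. \<forall>u\<in>U. mult a u \<in> U" and AW: "\<forall>a\<in>A. \<forall>w\<in>W. mult a w \<in> W"
    and nil: "\<forall>a\<in>A. \<forall>w\<in>W. \<exists>k. (mult a ^^ k) w \<in> U"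
  shows "\<exists>w\<in>W - U. \<forall>a\<in>A. mult a w \<in> U"
proof -
  obtain n where n: "derived A n \<subseteq> {0}"
    using A(2) by (auto simp: solvable_sub_def)
  have "\<exists>w\<in>W - U. \<forall>x\<in>derived A n. mult x w \<in> U"
    using n UW(3) subspace_0[OF UW(1)] by fastforce
  then have "\<exists>w\<in>W - U. \<forall>x\<in>derived A 0. mult x w \<in> U"
  proof (induction n)
    case (Suc n)
    have "\<exists>w\<in>W - U. \<forall>x\<in>derived A n. mult x w \<in> U"
    proof (rule engel_step[OF A(1) UW(1,2) AU AW nil _ _ _ _ Suc.prems])
      show "subspace (derived A n)"
        by (rule derived_subspace) (rule subalgebraD[OF A(1)])
    qed (use derived_subset[OF A(1)] derived_mult derived_right_ideal[OF A(1)] in blast)+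
    then show ?case by (rule Suc.IH)
  qed
  then show ?thesis by simp
qed

text \<open>Induction on the codimension of \<open>U\<close>: by \<open>engel\<close>, the space
  \<open>U'\<close> of elements that \<open>A\<close> multiplies into \<open>U\<close> is strictly
  larger than a proper \<open>U\<close>, and \<open>lcs A n\<close> inside \<open>U'\<close> puts
  the next term inside \<open>U\<close>. The claim is the case of zero \<open>U\<close>.\<close>

lemma engel_nilpotent:
  assumes A: "subalgebra A" "solvable_sub A"
    and nil: "\<forall>a\<in>A. \<forall>w\<in>A. \<exists>k. (mult a ^^ k) w = 0"
  shows "nilpotent_sub A"
proof -
  have sA: "subspace A" by (rule subalgebraD[OF A(1)])
  have "\<exists>n. lcs A n \<subseteq> U" if "subspace U" "U \<subseteq> A" "\<forall>a\<in>A. \<forall>u\<in>U. mult a u \<in> U" for U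
    using that
  proof (induction "dim A - dim U" arbitrary: U rule: less_induct)
    case less
    note U = less.prems
    show ?case
    proof (cases "U = A")
      case True
      then show ?thesis by (intro exI[of _ 0]) simp
    next
      case False
      have "\<forall>a\<in>A. \<forall>w\<in>A. \<exists>k. (mult a ^^ k) w \<in> U"
        using nil subspace_0[OF U(1)] by metis
      then have "\<exists>w\<in>A - U. \<forall>a\<in>A. mult a w \<in> U"
        using False U sA subalgebraD(2)[OF A(1)]
        by (intro engel[OF A]) auto
      then obtain w where w: "w \<in> A" "w \<notin> U" "\<forall>a\<in>A. mult a w \<in> U" by blast
      define U' where "U' = {v \<in> A. \<forall>a\<in>A. mult a v \<in> U}"
      have sU': "subspace U'"
        using subspace_inter[OF sA subspace_multiplier_left[OF U(1), of A]]
        by (simp add: U'_def Int_def)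
      have sub: "U \<subset> U'" using U w by (auto simp: U'_def)
      have "dim A - dim U' < dim A - dim U"
        using dim_less[OF U(1) sU' sub] dim_less[OF U(1) sA] False U(2) by fastforce
      moreover have "\<forall>a\<in>A. \<forall>u\<in>U'. mult a u \<in> U'"
        using sub by (auto simp: U'_def)
      ultimately obtain n where n: "lcs A n \<subseteq> U'"
        using less.hyps[OF _ sU'] by (auto simp: U'_def)
      have "lcs A (Suc n) \<subseteq> U"
        unfolding lcs.simps using n U(1) by (intro span_minimal) (auto simp: U'_def)
      then show ?thesis by blast
    qed
  qed
  from this[of "{0}"] show ?thesis
    using subspace_0[OF sA] by (auto simp: nilpotent_sub_def)
qed

text \<open>The Fitting null component of left multiplication by \<open>a\<close> on
  \<open>W/U\<close>, kept as a subspace of \<open>W\<close> so that no quotient space is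
  formed.\<close>

definition fitting_null :: "'v \<Rightarrow> 'v set \<Rightarrow> 'v set \<Rightarrow> 'v set" where
  "fitting_null a U W = {w\<in>W. \<exists>k. (mult a ^^ k) w \<in> U}"

lemma subspace_fitting_null:
  assumes "subspace U" "subspace W" "\<forall>u\<in>U. mult a u \<in> U"
  shows "subspace (fitting_null a U W)"
proof (rule subspaceI)
  show "0 \<in> fitting_null a U W"
    using subspace_0[OF assms(1)] subspace_0[OF assms(2)] by (auto simp: fitting_null_def)
next
  fix x y assume "x \<in> fitting_null a U W" "y \<in> fitting_null a U W"
  then obtain k l where kl: "x \<in> W" "y \<in> W" "(mult a ^^ k) x \<in> U" "(mult a ^^ l) y \<in> U"
    by (auto simp: fitting_null_def)
  have "(mult a ^^ (max k l)) (x + y) \<in> U"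
    unfolding mult_funpow_add
    by (intro subspace_add[OF assms(1)])
      (rule mult_funpow_mem_le[OF assms(3) kl(3)] mult_funpow_mem_le[OF assms(3) kl(4)], simp)+
  then show "x + y \<in> fitting_null a U W"
    using kl subspace_add[OF assms(2)] by (auto simp: fitting_null_def)
next
  fix c x assume "x \<in> fitting_null a U W"
  then show "scale c x \<in> fitting_null a U W"
    using subspace_scale[OF assms(1)] subspace_scale[OF assms(2)]
    by (auto simp: fitting_null_def mult_funpow_scale)
qed

text \<open>Left multiplication by \<open>a\<close> is a derivation: expanding one factor
  \<open>a\<close> lowers either \<open>i\<close> or \<open>j\<close>, so induction on
  \<open>i + j\<close> avoids binomial coefficients.\<close>

lemma funpow_mult_product:
  assumes "subspace U" and aU: "\<forall>u\<in>U. mult a u \<in> U" and DU: "\<forall>d\<in>D. \<forall>u\<in>U. mult d u \<in> U"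
    and aD: "\<forall>d\<in>D. mult a d \<in> D"
    and "d \<in> D" "(mult a ^^ i) d = 0" "(mult a ^^ j) w \<in> U"
  shows "(mult a ^^ (i + j)) (mult d w) \<in> U"
  using assms(5-)
proof (induction "i + j" arbitrary: i j d w)
  case 0
  then show ?case using subspace_0[OF assms(1)] by simp
next
  case (Suc n)
  consider "i = 0" | "j = 0" | i' j' where "i = Suc i'" "j = Suc j'"
    by (cases i; cases j) auto
  then show ?case
  proof cases
    case 1
    then show ?thesis using Suc.prems subspace_0[OF assms(1)] by simp
  next
    case 2
    then show ?thesis using Suc.prems DU mult_funpow_mem[OF aU] by simp
  next
    case 3
    have n: "n = i' + j" "n = i + j'" "i + j = Suc n" using Suc.hyps(2) 3 by auto
    have "(mult a ^^ i') (mult a d) = 0" "(mult a ^^ j') (mult a w) \<in> U" "mult a d \<in> D"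
      using Suc.prems 3 aD by (simp_all add: funpow_Suc_right del: funpow.simps(2))
    then have "(mult a ^^ n) (mult (mult a d) w) \<in> U" "(mult a ^^ n) (mult d (mult a w)) \<in> U"
      using Suc.hyps(1)[OF n(1)] Suc.hyps(1)[OF n(2)] Suc.prems n by auto
    moreover have "(mult a ^^ Suc n) (mult d w) =
        (mult a ^^ n) (mult (mult a d) w) + (mult a ^^ n) (mult d (mult a w))"
      by (simp only: funpow_Suc_right comp_apply left_leibniz[of a d] mult_funpow_add)
    ultimately show ?thesis
      using subspace_add[OF assms(1)] unfolding n(3) by simp
  qed
qed

text \<open>The decreasing spaces \<open>R n\<close>, the images of the powers plus
  \<open>U\<close>, become stationary. So the \<open>n\<close>-th power of \<open>w\<close> agrees
  modulo \<open>U\<close> with the \<open>2n\<close>-th power of some \<open>v\<close>, and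
  \<open>w\<close> splits into a null part and a part in the image.\<close>

lemma fitting:
  assumes "subspace U" "subspace W" and aU: "\<forall>u\<in>U. mult a u \<in> U" and aW: "\<forall>w\<in>W. mult a w \<in> W"
  obtains n where "n > 0" "\<forall>w\<in>W. \<exists>v\<in>W. (mult a ^^ n) (w - (mult a ^^ n) v) \<in> U"
proof -
  define R where "R n = {x + y | x y. x \<in> (mult a ^^ n) ` W \<and> y \<in> U}" for n
  have "subspace ((mult a ^^ n) ` W)" for n
    using assms(2) unfolding subspace_def
    by (safe; (unfold mult_funpow_add[symmetric] mult_funpow_scale[symmetric])?)
      (metis (no_types) image_eqI mult_funpow_zero, blast+)
  then have sR: "subspace (R n)" for n
    unfolding R_def by (rule subspace_sums) (rule assms(1))
  have dec: "R (m + n) \<subseteq> R m" for m n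
  proof
    fix x assume "x \<in> R (m + n)"
    then obtain w u where "x = (mult a ^^ m) ((mult a ^^ n) w) + u" "w \<in> W" "u \<in> U"
      by (auto simp: R_def funpow_add)
    then show "x \<in> R m"
      using mult_funpow_mem[OF aW] unfolding R_def by blast
  qed
  obtain m where m: "\<And>k. dim (R m) \<le> dim (R k)"
    using ex_has_least_nat[of "\<lambda>_. True" 0 "\<lambda>n. dim (R n)"] by auto
  \<comment> \<open>The successor makes \<open>n\<close> positive, so that
    \<open>(mult a ^^ n) v\<close> is a product with left factor \<open>a\<close>.\<close>
  define n where "n = Suc m"
  have eq: "R m = R (m + k)" for k
  proof (rule ccontr)
    assume "R m \<noteq> R (m + k)"
    then have "R (m + k) \<subset> R m" using dec[of m k] by blast
    then have "dim (R (m + k)) < dim (R m)" by (rule dim_less[OF sR sR])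
    then show False using m[of "m + k"] by linarith
  qed
  have "R n = R (n + n)"
    using eq[of "Suc 0"] eq[of "Suc n"] unfolding n_def add_Suc_right add_Suc add_0_right
    by (rule subst)
  moreover have "(mult a ^^ n) w \<in> R n" if "w \<in> W" for w
    unfolding R_def using that subspace_0[OF assms(1)]
    by (intro CollectI exI[of _ "(mult a ^^ n) w"] exI[of _ 0]) simp
  ultimately have RR: "(mult a ^^ n) w \<in> R (n + n)" if "w \<in> W" for w
    using that by blast
  have "\<exists>v\<in>W. (mult a ^^ n) (w - (mult a ^^ n) v) \<in> U" if "w \<in> W" for w
  proof -
    obtain v u where "v \<in> W" "u \<in> U" "(mult a ^^ n) w = (mult a ^^ n) ((mult a ^^ n) v) + u"
      using RR[OF \<open>w \<in> W\<close>] by (auto simp: R_def funpow_add)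
    then show ?thesis
      by (intro bexI[of _ v]) (simp_all add: mult_funpow_diff)
  qed
  then have "\<forall>w\<in>W. \<exists>v\<in>W. (mult a ^^ n) (w - (mult a ^^ n) v) \<in> U"
    by blast
  then show thesis
    using that[of n] by (simp add: n_def)
qed

text \<open>If all of \<open>C\<close> acts nilpotently on \<open>W/U\<close>, Engel's theorem gives
  \<open>U = W\<close>. Otherwise some \<open>c\<close> has a proper null component, which lies in
  \<open>X\<close> by induction on dimension, while the complementary part lies in
  \<open>c W\<close> and so in \<open>X\<close>.\<close>

lemma nilpotent_no_invariants:
  assumes C: "subalgebra C" "nilpotent_sub C" and UW: "subspace U" "subspace W" "U \<subseteq> W"
    and CU: "\<forall>c\<in>C. \<forall>u\<in>U. mult c u \<in> U" and CW: "\<forall>c\<in>C. \<forall>w\<in>W. mult c w \<in> W"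
    and inv: "\<And>w. w \<in> W \<Longrightarrow> \<forall>c\<in>C. mult c w \<in> U \<Longrightarrow> w \<in> U"
    and X: "subspace X" "U \<subseteq> X" "\<forall>c\<in>C. \<forall>w\<in>W. mult c w \<in> X"
  shows "W \<subseteq> X"
  using UW(2,3) CW inv X(3)
proof (induction "dim W" arbitrary: W rule: less_induct)
  case less
  show ?case
  proof (cases "\<forall>c\<in>C. \<forall>w\<in>W. \<exists>k. (mult c ^^ k) w \<in> U")
    case True
    then have "U = W"
      using engel[OF C(1) nilpotent_solvable[OF C] UW(1) less.prems(1)] less.prems CU by blast
    then show ?thesis using X by simp
  next
    case False
    then obtain c where c: "c \<in> C" "\<not> (\<forall>w\<in>W. \<exists>k. (mult c ^^ k) w \<in> U)" by blast
    have cU: "\<forall>u\<in>U. mult c u \<in> U" and cW: "\<forall>w\<in>W. mult c w \<in> W"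
      using c CU less.prems by auto
    let ?W0 = "fitting_null c U W"
    have sub: "?W0 \<subset> W" using c by (auto simp: fitting_null_def)
    have sW0: "subspace ?W0" by (rule subspace_fitting_null[OF UW(1) less.prems(1) cU])
    obtain m where m: "lcs C m \<subseteq> {0}" using C(2) by (auto simp: nilpotent_sub_def)
    have W0: "?W0 \<subseteq> X"
    proof (rule less.hyps[OF dim_less[OF sW0 less.prems(1) sub] sW0])
      show "U \<subseteq> ?W0"
        using less.prems(2) by (auto simp: fitting_null_def intro: exI[of _ 0])
      show "\<forall>d\<in>C. \<forall>w\<in>?W0. mult d w \<in> ?W0"
      proof safe
        fix d w assume d: "d \<in> C" and "w \<in> ?W0"
        then obtain k where w: "w \<in> W" "(mult c ^^ k) w \<in> U" by (auto simp: fitting_null_def)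
        \<comment> \<open>Nilpotency of \<open>C\<close> makes \<open>c\<close> act nilpotently on
          \<open>C\<close> itself, so \<open>C\<close> stabilizes the null component.\<close>
        have "(mult c ^^ m) d = 0" using lcs_funpow[OF c(1) d, of m] m by blast
        then have "(mult c ^^ (m + k)) (mult d w) \<in> U"
          using c(1) d w(2) C(1) CU
          by (intro funpow_mult_product[OF UW(1) cU, of C]) (auto simp: subalgebra_def)
        then show "mult d w \<in> ?W0"
          using d w less.prems(3) by (auto simp: fitting_null_def)
      qed
    qed (use sub less.prems in auto)
    obtain n where n: "n > 0" "\<forall>w\<in>W. \<exists>v\<in>W. (mult c ^^ n) (w - (mult c ^^ n) v) \<in> U"
      by (rule fitting[OF UW(1) less.prems(1) cU cW])
    show ?thesis
    proof
      fix w assume w: "w \<in> W"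
      then obtain v where v: "v \<in> W" "(mult c ^^ n) (w - (mult c ^^ n) v) \<in> U"
        using n by blast
      obtain n' where n': "n = Suc n'" using n(1) by (cases n) auto
      have "(mult c ^^ n) v \<in> X"
        using v c mult_funpow_mem[OF cW, of v n'] less.prems(5) by (simp add: n')
      moreover have "w - (mult c ^^ n) v \<in> X"
        using W0 w v subspace_diff[OF less.prems(1)] mult_funpow_mem[OF cW]
        by (auto simp: fitting_null_def)
      ultimately show "w \<in> X"
        using subspace_add[OF X(1)] by fastforce
    qed
  qed
qed

subsection \<open>Self-normalizing nilpotent subalgebras\<close>

text \<open>A nonzero left invariant \<open>w\<close> of \<open>H/C\<close> yields a two-sided one: take \<open>wx\<close> with \<open>x\<close> in the last
  term of the lower central series of \<open>C\<close> for which \<open>wx \<notin> C\<close>; then \<open>(wx)c = - (xw)c\<close>.\<close>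

lemma self_normalizing_left:
  assumes C: "subalgebra C" "nilpotent_sub C" "self_normalizing H C" and H: "subalgebra H" "C \<subseteq> H"
    and w: "w \<in> H" "\<forall>c\<in>C. mult c w \<in> C"
  shows "w \<in> C"
proof (rule ccontr)
  assume notin: "w \<notin> C"
  have norm: "v \<in> C" if "v \<in> H" "\<forall>c\<in>C. mult v c \<in> C \<and> mult c v \<in> C" for v
    using that C(3) by (auto simp: self_normalizing_def normalizer_def)
  let ?P = "\<lambda>k. \<forall>c\<in>lcs C k. mult w c \<in> C"
  obtain n where "lcs C n \<subseteq> {0}" using C(2) by (auto simp: nilpotent_sub_def)
  then have "?P n" using subspace_0[OF subalgebraD(1)[OF C(1)]] by auto
  then obtain k where k: "?P k" "\<And>j. j < k \<Longrightarrow> \<not> ?P j"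
    using exists_least_iff[of ?P] by blast
  \<comment> \<open>For \<open>k = 0\<close> the element \<open>w\<close> itself would normalize
    \<open>C\<close>.\<close>
  obtain j where j: "k = Suc j"
    using k(1) norm[OF w(1)] w(2) notin by (cases k) auto
  obtain x where x: "x \<in> lcs C j" "mult w x \<notin> C" using k(2)[of j] j by blast
  have xC: "x \<in> C" using x lcs_subset[OF C(1)] by blast
  have "mult w x \<in> C"
  proof (rule norm)
    show "mult w x \<in> H" using w xC H by (auto simp: subalgebra_def)
    show "\<forall>c\<in>C. mult (mult w x) c \<in> C \<and> mult c (mult w x) \<in> C"
    proof (intro ballI conjI)
      fix c assume c: "c \<in> C"
      show "mult (mult w x) c \<in> C"
        unfolding mult_mult_swap[of w]
        using w xC c C(1) by (intro subspace_neg) (auto simp: subalgebra_def)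
      have "mult w (mult c x) \<in> C"
        using k(1) lcs_mult[OF c x(1)] unfolding j by blast
      then show "mult c (mult w x) \<in> C"
        unfolding left_leibniz[of c] using w xC c C(1)
        by (intro subspace_add) (auto simp: subalgebra_def)
    qed
  qed
  with x show False by blast
qed

lemma self_normalizing_generates:
  assumes C: "subalgebra C" "nilpotent_sub C" "self_normalizing H C" and H: "subalgebra H" "C \<subseteq> H"
    and X: "subspace X" "C \<subseteq> X" "\<forall>c\<in>C. \<forall>h\<in>H. mult c h \<in> X"
  shows "H \<subseteq> X"
proof (rule nilpotent_no_invariants[OF C(1,2) _ _ H(2) _ _ _ X])
  show "\<And>w. w \<in> H \<Longrightarrow> \<forall>c\<in>C. mult c w \<in> C \<Longrightarrow> w \<in> C"
    by (rule self_normalizing_left[OF C H])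
qed (use C H in \<open>auto simp: subalgebra_def\<close>)

text \<open>Iterates \<open>H = C + C H\<close>: if \<open>H = X + lcs H k\<close>, then multiplying
  by \<open>C\<close> gives the same with \<open>Suc k\<close>, until the second summand is absorbed
  by \<open>X\<close>.\<close>

lemma self_normalizing_supplement:
  assumes C: "subalgebra C" "nilpotent_sub C" "self_normalizing H C" and H: "subalgebra H" "C \<subseteq> H"
    and X: "subspace X" "C \<subseteq> X" "\<forall>c\<in>C. \<forall>x\<in>X. mult c x \<in> X" and lcs: "lcs H n \<subseteq> X"
  shows "H \<subseteq> X"
proof -
  define Y where "Y k = {x + y | x y. x \<in> X \<and> y \<in> lcs H k}" for k
  have sL: "subspace (lcs H k)" for k
    by (rule lcs_subspace[OF subalgebraD(1)[OF H(1)]])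
  have sY: "subspace (Y k)" for k
    unfolding Y_def by (rule subspace_sums[OF X(1) sL])
  have XY: "X \<subseteq> Y k" for k
    unfolding Y_def using subspace_0[OF sL] by force
  have "H \<subseteq> Y k" for k
  proof (induction k)
    case 0
    then show ?case unfolding Y_def using subspace_0[OF X(1)] by force
  next
    case (Suc k)
    show ?case
    proof (rule self_normalizing_generates[OF C H sY])
      show "C \<subseteq> Y (Suc k)" using X(2) XY by blast
      show "\<forall>c\<in>C. \<forall>h\<in>H. mult c h \<in> Y (Suc k)"
      proof (intro ballI)
        fix c h assume c: "c \<in> C" and "h \<in> H"
        then obtain x y where xy: "h = x + y" "x \<in> X" "y \<in> lcs H k"
          using Suc.IH by (auto simp: Y_def)
        have "mult c x \<in> X" "mult c y \<in> lcs H (Suc k)"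
          using xy c X(3) H(2) lcs_mult by blast+
        then show "mult c h \<in> Y (Suc k)"
          unfolding xy(1) mult_add_right Y_def by blast
      qed
    qed
  qed
  moreover have "Y n \<subseteq> X"
    unfolding Y_def using lcs subspace_add[OF X(1)] by blast
  ultimately show ?thesis by blast
qed

text \<open>The normalizer condition for nilpotent algebras, obtained from the supplement lemma with
  \<open>C = X = U\<close>.\<close>

lemma nilpotent_self_normalizing_eq:
  assumes "subalgebra A" "nilpotent_sub A" "subalgebra U" "U \<subseteq> A" "self_normalizing A U"
  shows "U = A"
proof -
  obtain n where n: "lcs A n \<subseteq> {0}" using assms(2) by (auto simp: nilpotent_sub_def)
  have "A \<subseteq> U"
  proof (rule self_normalizing_supplement[where C = U and n = n])
    show "lcs A n \<subseteq> U" using n subspace_0[OF subalgebraD(1)[OF assms(3)]] by blast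
  qed (use assms nilpotent_sub_mono[OF assms(2,4)] in \<open>auto simp: subalgebra_def\<close>)
  then show ?thesis using assms(4) by blast
qed

lemma self_normalizing_mono: "self_normalizing A C \<Longrightarrow> C \<subseteq> H \<Longrightarrow> H \<subseteq> A \<Longrightarrow> self_normalizing H C"
  by (auto simp: self_normalizing_def normalizer_def)

lemma self_normalizing_above:
  assumes C: "subalgebra C" "nilpotent_sub C" "self_normalizing H C"
    and H: "subalgebra H" and M: "subalgebra M" "C \<subseteq> M" "M \<subseteq> H"
  shows "self_normalizing H M"
proof -
  let ?P = "normalizer H M"
  have MP: "M \<subseteq> ?P" by (rule subset_normalizer[OF M(1,3)])
  have "?P \<subseteq> M"
  proof (rule self_normalizing_generates[OF C(1,2)])
    show "self_normalizing ?P C"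
      using MP M by (intro self_normalizing_mono[OF C(3)]) (auto simp: normalizer_def)
    show "subalgebra ?P" by (rule subalgebra_normalizer[OF H subalgebraD(1)[OF M(1)]])
    show "\<forall>c\<in>C. \<forall>h\<in>?P. mult c h \<in> M" using M(2) by (auto simp: normalizer_def)
  qed (use M MP in \<open>auto simp: subalgebra_def\<close>)
  then show ?thesis using MP by (auto simp: self_normalizing_def)
qed

lemma cartan_in_M_set:
  assumes "cartan_subalgebra C"
  shows "C \<in> M_set"
proof -
  let ?R = "\<lambda>U V. maximal_subalgebra V U \<and> self_normalizing V U"
  have C: "subalgebra C" "nilpotent_sub C" "self_normalizing UNIV C"
    using assms nilpotent_alg_on_iff[of C] subalgebraD(1)[of C]
    by (simp_all add: cartan_subalgebra_def)
  \<comment> \<open>Replacing \<open>UNIV\<close> by any subalgebra \<open>H\<close> above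
    \<open>C\<close> permits induction on dimension.\<close>
  have "?R\<^sup>*\<^sup>* C H" if "subalgebra H" "C \<subseteq> H" for H
    using that
  proof (induction "dim H" arbitrary: H rule: less_induct)
    case less
    show ?case
    proof (cases "C = H")
      case False
      then have "C \<subset> H" using less.prems(2) by blast
      then obtain M where M: "maximal_subalgebra H M" "C \<subseteq> M"
        by (rule maximal_subalgebra_exists[OF less.prems(1) C(1)])
      have M': "subalgebra M" "M \<subset> H" using M by (auto simp: maximal_subalgebra_def)
      have "dim M < dim H"
        using M' less.prems(1) by (intro dim_less subalgebraD(1))
      then have "?R\<^sup>*\<^sup>* C M"
        by (rule less.hyps[OF _ M'(1) M(2)])
      moreover have "self_normalizing H M"
        using self_normalizing_mono[OF C(3) less.prems(2) subset_UNIV] M'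
        by (intro self_normalizing_above[OF C(1,2) _ less.prems(1) _ M(2)]) auto
      then have "?R M H" using M(1) by blast
      ultimately show ?thesis
        by (rule rtranclp.rtrancl_into_rtrancl)
    qed simp
  qed
  note chain = this
  have "subalgebra UNIV" by (simp add: subalgebra_def)
  then have "?R\<^sup>*\<^sup>* C UNIV"
    by (rule chain) (rule subset_UNIV)
  moreover have "\<not> (\<exists>U. ?R U C)"
  proof
    assume "\<exists>U. ?R U C"
    then obtain U where U: "subalgebra U" "U \<subset> C" "self_normalizing C U"
      by (auto simp only: maximal_subalgebra_def)
    show False
      using nilpotent_self_normalizing_eq[OF C(1,2) U(1) _ U(3)] U(2) by blast
  qed
  ultimately show ?thesis
    using C(1) by (simp add: M_set_def)
qed

subsection \<open>The members of \<open>M(L)\<close>\<close>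

text \<open>In a left Leibniz algebra \<open>a\<close> need not lie in the Fitting null component of its own left
  multiplication; it does after subtracting an element with zero left multiplication.\<close>

lemma fitting_null_representative:
  assumes A: "subalgebra A" "a \<in> A"
  obtains b where "b \<in> A" "mult b = mult a" "b \<in> fitting_null b {0} A"
proof -
  define S where "S = {s\<in>A. \<forall>z. mult s z = 0}"
  have sS: "subspace S"
    using A(1) unfolding S_def subalgebra_def subspace_def
    by (auto simp: mult_add_left mult_scale_left)
  have aS: "\<forall>s\<in>S. mult a s \<in> S"
    using A by (auto simp: S_def subalgebra_def mult_mult_eq)
  obtain n where n: "n > 0" "\<forall>w\<in>S. \<exists>v\<in>S. (mult a ^^ n) (w - (mult a ^^ n) v) \<in> {0}"
    by (rule fitting[of "{0}" S a]) (use sS aS in auto)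
  have "mult a a \<in> S" using A by (auto simp: S_def subalgebra_def)
  then obtain v where v: "v \<in> S" "(mult a ^^ n) (mult a a - (mult a ^^ n) v) = 0"
    using n by blast
  obtain n' where n': "n = Suc n'" using n(1) by (cases n) auto
  \<comment> \<open>One factor fewer than \<open>n\<close>, so that \<open>a s\<close> is the part
    \<open>(mult a ^^ n) v\<close> of \<open>a a\<close>. Then \<open>a (a - s)\<close> is the null
    part of \<open>a a\<close>.\<close>
  define s where "s = (mult a ^^ n') v"
  have s: "s \<in> S" unfolding s_def by (rule mult_funpow_mem[OF aS v(1)])
  have "mult (a - s) = mult a"
    using s by (auto simp: S_def mult_diff_left)
  moreover have "a - s \<in> A"
    using s A subspace_diff by (auto simp: S_def subalgebra_def)
  moreover have "mult a (a - s) = mult a a - (mult a ^^ n) v"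
    by (simp add: mult_diff_right s_def n')
  then have "(mult a ^^ Suc n) (a - s) = 0"
    using v(2) by (simp only: funpow_Suc_right comp_apply)
  ultimately show thesis
    by (intro that[of "a - s"]) (auto simp: fitting_null_def simp del: funpow.simps(2))
qed

lemma left_mult_nilpotent:
  assumes A: "subalgebra A" and max: "\<not> (\<exists>U. maximal_subalgebra A U \<and> self_normalizing A U)"
    and a: "a \<in> A" "w \<in> A"
  shows "\<exists>k. (mult a ^^ k) w = 0"
proof (rule ccontr)
  assume contr: "\<not> ?thesis"
  have sA: "subspace A" by (rule subalgebraD(1)[OF A])
  \<comment> \<open>Replacing \<open>a\<close> by \<open>b\<close> puts \<open>b\<close> into its
    own null component \<open>?A0\<close>, hence into any \<open>M\<close> above it.\<close>
  obtain b where b: "b \<in> A" "mult b = mult a" "b \<in> fitting_null b {0} A"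
    by (rule fitting_null_representative[OF A a(1)])
  let ?A0 = "fitting_null b {0} A"
  have "mult d v \<in> ?A0" if dv: "d \<in> ?A0" "v \<in> ?A0" for d v
  proof -
    obtain i j where ij: "(mult b ^^ i) d = 0" "(mult b ^^ j) v \<in> {0}"
      using dv by (auto simp: fitting_null_def)
    have "(mult b ^^ (i + j)) (mult d v) \<in> {0}"
      by (rule funpow_mult_product[of "{0}" b UNIV d i j v]) (use ij in auto)
    then show ?thesis
      using dv A by (auto simp: fitting_null_def subalgebra_def)
  qed
  then have A0: "subalgebra ?A0"
    using subspace_fitting_null[of "{0}" A b] sA by (auto simp: subalgebra_def)
  have "?A0 \<subset> A" using a contr b(2) by (auto simp: fitting_null_def)
  then obtain M where M: "maximal_subalgebra A M" "?A0 \<subseteq> M"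
    using maximal_subalgebra_exists[OF A A0] by blast
  have M': "subalgebra M" "M \<subset> A" using M by (auto simp: maximal_subalgebra_def)
  \<comment> \<open>The normalizer is a subalgebra strictly above \<open>M\<close>, so maximality
    makes \<open>M\<close> an ideal of \<open>A\<close>.\<close>
  have "normalizer A M = A"
    using M(1) max subset_normalizer[OF M'(1)] subalgebra_normalizer[OF A subalgebraD(1)[OF M'(1)]]
    unfolding maximal_subalgebra_def self_normalizing_def
    by (metis (no_types, lifting) mem_Collect_eq normalizer_def psubset_imp_subset subsetI)
  then have ideal: "\<forall>x\<in>A. mult b x \<in> M"
    using b(3) M(2) by (auto simp: normalizer_def)
  have bA: "\<forall>x\<in>A. mult b x \<in> A" using b(1) A by (auto simp: subalgebra_def)
  obtain n where n: "n > 0" "\<forall>x\<in>A. \<exists>v\<in>A. (mult b ^^ n) (x - (mult b ^^ n) v) \<in> {0}"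
    by (rule fitting[of "{0}" A b]) (use sA bA in auto)
  obtain n' where n': "n = Suc n'" using n(1) by (cases n) auto
  have "x \<in> M" if x: "x \<in> A" for x
  proof -
    obtain v where v: "v \<in> A" "(mult b ^^ n) (x - (mult b ^^ n) v) = 0"
      using n x by blast
    have "(mult b ^^ n) v \<in> M"
      using ideal mult_funpow_mem[OF bA v(1)] by (simp add: n')
    moreover have "x - (mult b ^^ n) v \<in> ?A0"
      using v subspace_diff[OF sA x] mult_funpow_mem[OF bA v(1)] by (auto simp: fitting_null_def)
    ultimately show ?thesis
      using M(2) subspace_add[OF subalgebraD(1)[OF M'(1)]] by fastforce
  qed
  then show False using M'(2) by blast
qed

lemma self_normalizing_step:
  assumes N: "leibniz_ideal N" "nilpotent_sub N" "lcs UNIV n \<subseteq> N"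
    and M: "maximal_subalgebra H M" "self_normalizing H M"
    and A: "subalgebra A" "nilpotent_sub A" "A \<subseteq> M" "self_normalizing M A"
  shows "self_normalizing H A"
proof -
  define K where "K = M \<inter> N"
  have H: "subalgebra H" "subalgebra M" "M \<subset> H" using M by (auto simp: maximal_subalgebra_def)
  have sub: "subspace M" "subspace N" "subspace H" using H N(1)
    by (auto simp: subalgebra_def leibniz_ideal_def)
  have sK: "subspace K" unfolding K_def by (rule subspace_inter[OF sub(1,2)])
  have K: "subalgebra K"
    using sK H(2) N(1) by (auto simp: K_def subalgebra_def leibniz_ideal_def)
  have HN: "subalgebra (H \<inter> N)"
    using subspace_inter[OF sub(3,2)] H(1) N(1) by (auto simp: subalgebra_def leibniz_ideal_def)
  let ?P = "normalizer H K"
  have P: "subalgebra ?P" by (rule subalgebra_normalizer[OF H(1) sK])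
  have MP: "M \<subseteq> ?P"
    using H(2,3) N(1) by (auto simp: normalizer_def K_def subalgebra_def leibniz_ideal_def)
  have "?P = H"
  proof (cases "K = H \<inter> N")
    case True
    then show ?thesis
      using H(1) N(1) by (auto simp: normalizer_def subalgebra_def leibniz_ideal_def)
  next
    case False
    \<comment> \<open>The normalizer condition in the nilpotent \<open>H \<inter> N\<close> gives an
      \<open>x\<close> outside \<open>M\<close> that normalizes \<open>K\<close>. Maximality of
      \<open>M\<close> then forces \<open>?P = H\<close>.\<close>
    have "K \<subseteq> H \<inter> N" using H(3) by (auto simp: K_def)
    then have "\<not> self_normalizing (H \<inter> N) K"
      using nilpotent_self_normalizing_eq[OF HN _ K] False nilpotent_sub_mono[OF N(2)] by blast
    then have "normalizer (H \<inter> N) K \<noteq> K" by (simp add: self_normalizing_def)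
    then obtain x where "x \<in> normalizer (H \<inter> N) K" "x \<notin> K"
      using subset_normalizer[OF K \<open>K \<subseteq> H \<inter> N\<close>] by blast
    then have "x \<in> ?P" "x \<notin> M" by (auto simp: normalizer_def K_def)
    then show ?thesis
      using M(1) P MP unfolding maximal_subalgebra_def
      by (metis (no_types, lifting) mem_Collect_eq normalizer_def subsetI)
  qed
  then have KH: "mult x k \<in> K" "mult k x \<in> K" if "x \<in> H" "k \<in> K" for x k
    using that by (auto simp: normalizer_def)
  have sAK: "subspace {a + k | a k. a \<in> A \<and> k \<in> K}"
    by (rule subspace_sums[OF subalgebraD(1)[OF A(1)] sK])
  have MAK: "M \<subseteq> {a + k | a k. a \<in> A \<and> k \<in> K}"
  proof (rule self_normalizing_supplement[OF A(1,2,4) H(2) A(3) sAK])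
    show "A \<subseteq> {a + k | a k. a \<in> A \<and> k \<in> K}" using subspace_0[OF sK] by force
    show "\<forall>c\<in>A. \<forall>x\<in>{a + k | a k. a \<in> A \<and> k \<in> K}. mult c x \<in> {a + k | a k. a \<in> A \<and> k \<in> K}"
    proof safe
      fix c a k assume "c \<in> A" "a \<in> A" "k \<in> K"
      moreover from this have "mult c a \<in> A" "mult c k \<in> K"
        using A H KH by (auto simp: subalgebra_def)
      ultimately show "\<exists>a' k'. mult c (a + k) = a' + k' \<and> a' \<in> A \<and> k' \<in> K"
        using mult_add_right by blast
    qed
    have "lcs M n \<subseteq> K"
      using lcs_mono[of M UNIV n] lcs_subset[OF H(2)] N(3) by (auto simp: K_def)
    then show "lcs M n \<subseteq> {a + k | a k. a \<in> A \<and> k \<in> K}"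
      using subspace_0[OF subalgebraD(1)[OF A(1)]] by force
  qed
  have "x \<in> A" if x: "x \<in> normalizer H A" for x
  proof -
    have xH: "x \<in> H" and xA: "\<And>a. a \<in> A \<Longrightarrow> mult x a \<in> A" "\<And>a. a \<in> A \<Longrightarrow> mult a x \<in> A"
      using x by (auto simp: normalizer_def)
    \<comment> \<open>Multiplication by \<open>x\<close> on either side preserves both summands of
      \<open>M = A + K\<close>.\<close>
    have "mult x m \<in> M \<and> mult m x \<in> M" if "m \<in> M" for m
    proof -
      obtain a k where "m = a + k" "a \<in> A" "k \<in> K" using MAK \<open>m \<in> M\<close> by blast
      then show ?thesis
        using xA[of a] KH[OF xH, of k] A(3) subspace_add[OF sub(1)]
        by (auto simp: mult_add_left mult_add_right K_def)
    qed
    then have "x \<in> M"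
      using M(2) xH by (auto simp: self_normalizing_def normalizer_def)
    then show ?thesis
      using A(4) x by (auto simp: self_normalizing_def normalizer_def)
  qed
  then show ?thesis
    using subset_normalizer[OF A(1), of H] A(3) H(3) by (auto simp: self_normalizing_def)
qed

lemma M_set_cartan:
  assumes N: "leibniz_ideal N" "nilpotent_sub N" "lcs UNIV n \<subseteq> N" and "A \<in> M_set"
  shows "cartan_subalgebra A"
proof -
  let ?R = "\<lambda>U V. maximal_subalgebra V U \<and> self_normalizing V U"
  have A: "subalgebra A" and chain: "?R\<^sup>*\<^sup>* A UNIV" and max: "\<not> (\<exists>U. ?R U A)"
    using assms(4) by (auto simp: M_set_def)
  obtain m where m: "lcs N m \<subseteq> {0}" using N(2) by (auto simp: nilpotent_sub_def)
  have N': "subalgebra N"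
    using N(1) by (auto simp: leibniz_ideal_def subalgebra_def)
  have "derived A n \<subseteq> N"
    using derived_mono[of A UNIV n] derived_subset_lcs[of UNIV n] N(3)
    by (auto simp: subalgebra_def)
  \<comment> \<open>After \<open>n\<close> steps the derived series of \<open>A\<close> is inside
    \<open>N\<close>, and \<open>m\<close> further steps exhaust \<open>N\<close>. This gives the
    solvability required by Engel's theorem.\<close>
  then have "derived A (n + m) \<subseteq> {0}"
    using derived_mono[of _ N m] derived_subset_lcs[OF N', of m] m
    unfolding derived_add[symmetric] by blast
  then have "solvable_sub A" by (auto simp: solvable_sub_def)
  then have nil: "nilpotent_sub A"
    using left_mult_nilpotent[OF A max] by (intro engel_nilpotent[OF A]) auto
  \<comment> \<open>The inclusion is vacuous for \<open>UNIV\<close>, but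
    \<open>self_normalizing_step\<close> requires it at the intermediate links.\<close>
  from chain have "A \<subseteq> UNIV \<and> self_normalizing UNIV A"
  proof (induction rule: rtranclp_induct)
    case base
    then show ?case
      using subset_normalizer[OF A] by (auto simp: self_normalizing_def normalizer_def)
  next
    case (step M H)
    then show ?case
      using self_normalizing_step[OF N, of H M A] A nil by (auto simp: maximal_subalgebra_def)
  qed
  then show ?thesis
    using A nil nilpotent_alg_on_iff[OF subalgebraD(1)[OF A]] by (simp add: cartan_subalgebra_def)
qed

text \<open>For \<open>t = 2\<close> the ideal is the middle term \<open>I 1\<close>. For smaller
  \<open>t\<close> the whole algebra is nilpotent, and \<open>N = UNIV\<close> with
  \<open>n = 0\<close> gives the same form.\<close>

lemma nilpotent_length_le_2:
  assumes "has_nilpotent_length t" "t \<le> 2"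
  obtains N n where "leibniz_ideal N" "nilpotent_sub N" "lcs UNIV n \<subseteq> N"
proof -
  obtain I where I: "I 0 = {0}" "I t = UNIV" "\<forall>i\<le>t. leibniz_ideal (I i)"
    "\<forall>i<t. I i \<subseteq> I (Suc i) \<and> nilpotent_alg (factor (I (Suc i)) (I i))"
    using assms(1) by (auto simp: has_nilpotent_length_def nilpotent_chain_def)
  consider "t = 0" | "t = 1" | "t = 2" using assms(2) by linarith
  note cases = this
  have UNIV_ideal: "leibniz_ideal UNIV"
    using I(2,3) by (metis order_refl)
  have step: "\<exists>n. lcs (I (Suc i)) n \<subseteq> I i" if "i < t" for i
    using I(3,4) that nilpotent_factor_lcs[of "I i" "I (Suc i)"] by (metis less_imp_le)
  from cases show thesis
  proof cases
    case 1
    then show thesis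
      using that[of UNIV 0] I by (auto simp: nilpotent_sub_def intro!: exI[of _ 0])
  next
    case 2
    then obtain n where "lcs UNIV n \<subseteq> {0}"
      using step[of 0] I by auto
    then show thesis
      using that[of UNIV 0] UNIV_ideal by (auto simp: nilpotent_sub_def)
  next
    case 3
    obtain m where "lcs (I 1) m \<subseteq> {0}"
      using step[of 0] I 3 by auto
    moreover obtain n where "lcs UNIV n \<subseteq> I 1"
      using step[of 1] I 3 by (auto simp: numeral_2_eq_2)
    ultimately show thesis
      using that[of "I 1" n] I 3 by (auto simp: nilpotent_sub_def)
  qed
qed

end

theorem theorem8:
  fixes scale :: "'k::field \<Rightarrow> 'v::ab_group_add \<Rightarrow> 'v"
    and mult :: "'v \<Rightarrow> 'v \<Rightarrow> 'v"
  assumes "leibniz_algebra scale mult"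
    and "\<exists>t\<le>2. leibniz_algebra.has_nilpotent_length scale mult t"
  shows "{C. leibniz_algebra.cartan_subalgebra scale mult C} = leibniz_algebra.M_set scale mult"
proof -
  interpret leibniz_algebra scale mult by fact
  obtain N n where "leibniz_ideal N" "nilpotent_sub N" "lcs UNIV n \<subseteq> N"
    using assms(2) nilpotent_length_le_2 by blast
  then show ?thesis
    using cartan_in_M_set M_set_cartan by blast
qed

end
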